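(* Let $n\ge1$. The mapping $$\chi=\prod_{i=0}^n\chi_i:\ \prod_{i=0}^nA_1^i\ \longrightarrow\ \tilde P_+=\{(p_i,x^i)\in\tilde P\mid p_i>0,\ i=0,\dots,n\}$$ defined by $$\prod_{i=0}^n\begin{pmatrix}h_i&z_i\\0&1\end{pmatrix}\ \longmapsto\ \{(p_i,x^i)=(h_i,\,-h_i^{-1}z_i)\}_{i=0}^n$$ defines a symplectomorphism of the symplectic space $\bigl(\tilde P_+,\ d\bigl(\sum_{i=0}^np_i\,dx^i\bigr)\bigr)$ with the product $\prod_{i=0}^nA_1^i$ of $n+1$ copies of the affine group $A_1$ endowed with the symplectic structure generated by the right invariant 1-form $-\sum_{i=0}^n(dz_i-z_ih_i^{-1}dh_i)$, i.e. with the exterior derivative of this form.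
   Context: $\tilde P=\mathbb{R}^{2n+2}$ has coordinates $(p_0,\dots,p_n;x^0,\dots,x^n)$, 1-form $\tilde\theta=\sum_{i=0}^np_i\,dx^i$ and symplectic form $d\tilde\theta=\sum_{i=0}^ndp_i\wedge dx^i$. $A_1$ is the Lie group of matrices $\begin{pmatrix}h&z\\0&1\end{pmatrix}$ with $h>0$, $z\in\mathbb{R}$, under matrix multiplication; $A_1^i$ denotes the $i$-th copy, with coordinates $(h_i,z_i)$. Right invariant means invariant under all right translations of the product group. *)

theory Defs
  imports "HOL-Analysis.Analysis" "HOL-Algebra.Product_Groups"
begin

section \<open>Differential forms on open subsets of Euclidean spaces\<close>

primrec C_k_on :: "nat \<Rightarrow> ('a::euclidean_space \<Rightarrow> 'b::real_normed_vector) \<Rightarrow> 'a set \<Rightarrow> bool" where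
  "C_k_on 0 f U \<longleftrightarrow> continuous_on U f"
| "C_k_on (Suc k) f U \<longleftrightarrow> (\<forall>x\<in>U. f differentiable (at x)) \<and>
     (\<forall>v. C_k_on k (\<lambda>x. frechet_derivative f (at x) v) U)"

text \<open>This is the usual notion only for open \<open>U\<close>, the only case in which it is used.\<close>

definition smooth_on :: "('a::euclidean_space \<Rightarrow> 'b::real_normed_vector) \<Rightarrow> 'a set \<Rightarrow> bool" where
  "smooth_on f U \<longleftrightarrow> (\<forall>k. C_k_on k f U)"

type_synonym 'a one_form = "'a \<Rightarrow> 'a \<Rightarrow> real"
type_synonym 'a two_form = "'a \<Rightarrow> 'a \<Rightarrow> 'a \<Rightarrow> real"

text \<open>The first argument of a form is the base point, the others are tangent vectors.\<close>

definition one_form_on :: "'a::euclidean_space set \<Rightarrow> 'a one_form \<Rightarrow> bool" where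
  "one_form_on U \<alpha> \<longleftrightarrow> (\<forall>x\<in>U. linear (\<alpha> x)) \<and> (\<forall>v. smooth_on (\<lambda>x. \<alpha> x v) U)"

definition two_form_on :: "'a::euclidean_space set \<Rightarrow> 'a two_form \<Rightarrow> bool" where
  "two_form_on U \<omega> \<longleftrightarrow> (\<forall>x\<in>U. bilinear (\<omega> x) \<and> (\<forall>v. \<omega> x v v = 0)) \<and>
     (\<forall>v w. smooth_on (\<lambda>x. \<omega> x v w) U)"

text \<open>Exterior derivatives, evaluated on constant vector fields (whose brackets vanish), with the
  normalisation \<open>d\<alpha>(X,Y) = X(\<alpha>(Y)) - Y(\<alpha>(X)) - \<alpha>([X,Y])\<close>, so that
  \<open>(\<alpha> \<and> \<beta>)(X,Y) = \<alpha>(X) \<beta>(Y) - \<alpha>(Y) \<beta>(X)\<close>.\<close>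

definition ext_deriv1 :: "'a::euclidean_space one_form \<Rightarrow> 'a two_form" where
  "ext_deriv1 \<alpha> x u v =
     frechet_derivative (\<lambda>y. \<alpha> y v) (at x) u - frechet_derivative (\<lambda>y. \<alpha> y u) (at x) v"

definition ext_deriv2 :: "'a::euclidean_space two_form \<Rightarrow> 'a \<Rightarrow> 'a \<Rightarrow> 'a \<Rightarrow> 'a \<Rightarrow> real" where
  "ext_deriv2 \<omega> x u v w =
     frechet_derivative (\<lambda>y. \<omega> y v w) (at x) u
     - frechet_derivative (\<lambda>y. \<omega> y u w) (at x) v
     + frechet_derivative (\<lambda>y. \<omega> y u v) (at x) w"

definition pullback1 :: "('a::euclidean_space \<Rightarrow> 'b::euclidean_space) \<Rightarrow> 'b one_form \<Rightarrow> 'a one_form" where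
  "pullback1 f \<alpha> x v = \<alpha> (f x) (frechet_derivative f (at x) v)"

definition pullback2 :: "('a::euclidean_space \<Rightarrow> 'b::euclidean_space) \<Rightarrow> 'b two_form \<Rightarrow> 'a two_form" where
  "pullback2 f \<omega> x v w =
     \<omega> (f x) (frechet_derivative f (at x) v) (frechet_derivative f (at x) w)"

definition symplectic_form_on :: "'a::euclidean_space set \<Rightarrow> 'a two_form \<Rightarrow> bool" where
  "symplectic_form_on U \<omega> \<longleftrightarrow> two_form_on U \<omega> \<and>
     (\<forall>x\<in>U. \<forall>u v w. ext_deriv2 \<omega> x u v w = 0) \<and>
     (\<forall>x\<in>U. \<forall>v. (\<forall>w. \<omega> x v w = 0) \<longrightarrow> v = 0)"


section \<open>Manifolds with a global chart\<close>

text \<open>A manifold is a set \<open>M\<close> together with a global chart \<open>\<phi>\<close>, which carries \<open>M\<close> bijectively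
  onto an open subset of a Euclidean space. Forms on \<open>M\<close> are given by their expressions in this
  chart, that is, as forms on \<open>\<phi> ` M\<close>.\<close>

definition global_chart :: "'m set \<Rightarrow> ('m \<Rightarrow> 'a::euclidean_space) \<Rightarrow> bool" where
  "global_chart M \<phi> \<longleftrightarrow> inj_on \<phi> M \<and> open (\<phi> ` M)"

definition in_charts ::
  "'m set \<Rightarrow> ('m \<Rightarrow> 'a::euclidean_space) \<Rightarrow> ('k \<Rightarrow> 'b::euclidean_space) \<Rightarrow> ('m \<Rightarrow> 'k) \<Rightarrow> 'a \<Rightarrow> 'b" where
  "in_charts M \<phi> \<psi> f = \<psi> \<circ> f \<circ> inv_into M \<phi>"

definition diffeomorphism ::
  "'m set \<Rightarrow> ('m \<Rightarrow> 'a::euclidean_space) \<Rightarrow> 'k set \<Rightarrow> ('k \<Rightarrow> 'b::euclidean_space) \<Rightarrow> ('m \<Rightarrow> 'k) \<Rightarrow> bool" where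
  "diffeomorphism M \<phi> N \<psi> f \<longleftrightarrow> bij_betw f M N \<and>
     smooth_on (in_charts M \<phi> \<psi> f) (\<phi> ` M) \<and>
     smooth_on (in_charts N \<psi> \<phi> (inv_into M f)) (\<psi> ` N)"

definition symplectic_space :: "'m set \<Rightarrow> ('m \<Rightarrow> 'a::euclidean_space) \<Rightarrow> 'a two_form \<Rightarrow> bool" where
  "symplectic_space M \<phi> \<omega> \<longleftrightarrow> global_chart M \<phi> \<and> symplectic_form_on (\<phi> ` M) \<omega>"

definition symplectomorphism ::
  "'m set \<Rightarrow> ('m \<Rightarrow> 'a::euclidean_space) \<Rightarrow> 'a two_form \<Rightarrow>
   'k set \<Rightarrow> ('k \<Rightarrow> 'b::euclidean_space) \<Rightarrow> 'b two_form \<Rightarrow> ('m \<Rightarrow> 'k) \<Rightarrow> bool" where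
  "symplectomorphism M \<phi> \<omega> N \<psi> \<sigma> f \<longleftrightarrow>
     symplectic_space M \<phi> \<omega> \<and> symplectic_space N \<psi> \<sigma> \<and> diffeomorphism M \<phi> N \<psi> f \<and>
     (\<forall>x\<in>\<phi> ` M. pullback2 (in_charts M \<phi> \<psi> f) \<sigma> x = \<omega> x)"

definition right_invariant_one_form ::
  "('m, 'z) monoid_scheme \<Rightarrow> ('m \<Rightarrow> 'a::euclidean_space) \<Rightarrow> 'a one_form \<Rightarrow> bool" where
  "right_invariant_one_form G \<phi> \<alpha> \<longleftrightarrow> one_form_on (\<phi> ` carrier G) \<alpha> \<and>
     (\<forall>b\<in>carrier G. \<forall>x\<in>\<phi> ` carrier G.
        pullback1 (in_charts (carrier G) \<phi> \<phi> (\<lambda>g. g \<otimes>\<^bsub>G\<^esub> b)) \<alpha> x = \<alpha> x)"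


section \<open>The affine group and its powers\<close>

definition affine_matrix :: "real \<Rightarrow> real \<Rightarrow> real^2^2" where
  "affine_matrix h z = vector [vector [h, z], vector [0, 1]]"

definition A1 :: "(real^2^2) monoid" where
  "A1 = \<lparr>carrier = {affine_matrix h z | h z. h > 0}, mult = (**), one = mat 1\<rparr>"

lemma affine_matrix_nth [simp]:
  "affine_matrix h z $ 1 $ 1 = h" "affine_matrix h z $ 1 $ 2 = z"
  "affine_matrix h z $ 2 $ 1 = 0" "affine_matrix h z $ 2 $ 2 = 1"
  by (simp_all add: affine_matrix_def)

lemma affine_matrix_mult:
  "affine_matrix h z ** affine_matrix a b = affine_matrix (h * a) (h * b + z)"
  by (simp add: vec_eq_iff forall_2 matrix_matrix_mult_def sum_2)

lemma affine_matrix_one: "mat 1 = affine_matrix 1 0"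
  by (simp add: vec_eq_iff forall_2 mat_def)

lemma group_A1: "group A1"
proof (rule groupI)
  fix x assume "x \<in> carrier A1"
  then obtain h z where x: "x = affine_matrix h z" "h > 0"
    by (auto simp: A1_def)
  then have "affine_matrix (1 / h) (- z / h) ** x = mat 1"
    by (simp add: affine_matrix_mult affine_matrix_one)
  moreover have "affine_matrix (1 / h) (- z / h) \<in> carrier A1"
    unfolding A1_def using x(2) by simp (metis zero_less_divide_1_iff)
  ultimately show "\<exists>y\<in>carrier A1. y \<otimes>\<^bsub>A1\<^esub> x = \<one>\<^bsub>A1\<^esub>"
    unfolding A1_def by auto
next
  fix x y assume "x \<in> carrier A1" "y \<in> carrier A1"
  then show "x \<otimes>\<^bsub>A1\<^esub> y \<in> carrier A1"
    unfolding A1_def by (auto simp: affine_matrix_mult) (metis mult_pos_pos)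
next
  show "\<one>\<^bsub>A1\<^esub> \<in> carrier A1"
    unfolding A1_def by (simp add: affine_matrix_one) (metis zero_less_one)
qed (auto simp: A1_def matrix_mul_assoc)

text \<open>The index type \<open>'i\<close> plays the role of \<open>{0,\<dots>,n}\<close>.\<close>

definition A1_prod :: "('i::finite \<Rightarrow> real^2^2) monoid" where
  "A1_prod = product_group UNIV (\<lambda>_. A1)"

text \<open>The coordinates \<open>(h, z)\<close>.\<close>

definition hz :: "('i::finite \<Rightarrow> real^2^2) \<Rightarrow> (real^'i) \<times> (real^'i)" where
  "hz g = ((\<chi> i. g i $ 1 $ 1), (\<chi> i. g i $ 1 $ 2))"

text \<open>The form \<open>- (\<Sum>i. dz\<^sub>i - z\<^sub>i h\<^sub>i\<^sup>-\<^sup>1 dh\<^sub>i)\<close> in these coordinates.\<close>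

definition hz_form :: "((real^'i::finite) \<times> (real^'i)) one_form" where
  "hz_form = (\<lambda>(h, z) (dh, dz). - (\<Sum>i\<in>UNIV. dz $ i - z $ i * inverse (h $ i) * dh $ i))"


section \<open>The phase space\<close>

definition P_plus :: "((real^'i::finite) \<times> (real^'i)) set" where
  "P_plus = {(p, x). \<forall>i. p $ i > 0}"

definition theta_form :: "((real^'i::finite) \<times> (real^'i)) one_form" where
  "theta_form = (\<lambda>(p, x) (dp, dx). \<Sum>i\<in>UNIV. p $ i * dx $ i)"

text \<open>The single factor \<open>chi_factor\<close> is defined through the matrix entries; on
  \<open>affine_matrix h z\<close> it takes the value \<open>(h, - h\<^sup>-\<^sup>1 z)\<close>.\<close>

definition chi_factor :: "real^2^2 \<Rightarrow> real \<times> real" where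
  "chi_factor A = (A $ 1 $ 1, - inverse (A $ 1 $ 1) * A $ 1 $ 2)"

definition chi_map :: "('i::finite \<Rightarrow> real^2^2) \<Rightarrow> (real^'i) \<times> (real^'i)" where
  "chi_map g = ((\<chi> i. fst (chi_factor (g i))), (\<chi> i. snd (chi_factor (g i))))"

end

theory Submission
  imports Defs
begin

text \<open>In the coordinates \<open>(h, z)\<close> the map \<open>\<chi>\<close> is \<open>(h, z) \<mapsto> (h, - z / h)\<close>, with inverse
  \<open>(p, x) \<mapsto> (p, - p x)\<close>, and both invariance and symplecticity are
  computations with the two forms \<open>\<Sum>\<^sub>i (dz\<^sub>i \<and> dh\<^sub>i) / h\<^sub>i\<close> and \<open>\<Sum>\<^sub>i dp\<^sub>i \<and> dx\<^sub>i\<close>. A right translation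
  is \<open>(h, z) \<mapsto> (h a, h c + z)\<close>, hence the restriction of a linear map.\<close>

section \<open>Smooth functions on open sets\<close>

lemma C_k_on_cong:
  assumes "open U" "\<And>x. x \<in> U \<Longrightarrow> f x = g x" "C_k_on k f U"
  shows "C_k_on k g U"
  using assms(2,3)
proof (induction k arbitrary: f g)
  case 0
  then show ?case by (simp cong: continuous_on_cong)
next
  case (Suc k)
  \<comment> \<open>Since \<open>U\<close> is open, agreement on \<open>U\<close> is agreement near
    each of its points, so derivatives agree too and the induction can pass to them.\<close>
  have D: "(g has_derivative frechet_derivative f (at x)) (at x)" if "x \<in> U" for x
  proof (rule has_derivative_transform_within_open[OF _ \<open>open U\<close> that])
    show "(f has_derivative frechet_derivative f (at x)) (at x)"
      using Suc.prems(2) that by (simp add: frechet_derivative_works)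
  qed (rule Suc.prems(1))
  then have eq: "frechet_derivative g (at x) = frechet_derivative f (at x)" if "x \<in> U" for x
    using frechet_derivative_at[OF D[OF that]] by simp
  have "C_k_on k (\<lambda>x. frechet_derivative g (at x) v) U" for v
  proof (rule Suc.IH)
    show "C_k_on k (\<lambda>x. frechet_derivative f (at x) v) U"
      using Suc.prems(2) by simp
  qed (simp add: eq)
  with D show ?case unfolding C_k_on.simps differentiable_def by blast
qed

text \<open>Allows any explicit derivative in place of the chosen \<open>frechet_derivative\<close>,
  so that the rules below follow from the \<open>has_derivative\<close> calculus.\<close>

lemma C_k_on_SucI:
  assumes "open U" "\<And>x. x \<in> U \<Longrightarrow> (f has_derivative f' x) (at x)"
    "\<And>v. C_k_on k (\<lambda>x. f' x v) U"
  shows "C_k_on (Suc k) f U"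
proof -
  have "C_k_on k (\<lambda>x. frechet_derivative f (at x) v) U" for v
    by (rule C_k_on_cong[OF assms(1) _ assms(3)[of v]])
      (simp add: frechet_derivative_at[OF assms(2), symmetric])
  with assms(2) show ?thesis by (auto simp: differentiable_def)
qed

lemma C_k_on_SucD:
  assumes "C_k_on (Suc k) f U"
  shows "\<And>x. x \<in> U \<Longrightarrow> (f has_derivative frechet_derivative f (at x)) (at x)"
    "\<And>v. C_k_on k (\<lambda>x. frechet_derivative f (at x) v) U"
  using assms by (auto simp: frechet_derivative_works)

lemma C_k_on_Suc_imp:
  "C_k_on (Suc k) f U \<Longrightarrow> C_k_on k f U"
proof (induction k arbitrary: f)
  case 0
  then show ?case
    by (auto intro!: continuous_at_imp_continuous_on differentiable_imp_continuous_within)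
qed auto

lemma C_k_on_const: "C_k_on k (\<lambda>_. c) U"
  by (induction k arbitrary: c) (auto simp: frechet_derivative_const)

lemma C_k_on_add:
  assumes "open U" "C_k_on k f U" "C_k_on k g U"
  shows "C_k_on k (\<lambda>x. f x + g x) U"
  using assms(2,3)
proof (induction k arbitrary: f g)
  case 0
  then show ?case by (auto intro: continuous_on_add)
next
  case (Suc k)
  note f = C_k_on_SucD[OF Suc.prems(1)] and g = C_k_on_SucD[OF Suc.prems(2)]
  show ?case
    by (rule C_k_on_SucI[OF \<open>open U\<close> has_derivative_add[OF f(1) g(1)] Suc.IH[OF f(2) g(2)]])
qed

lemma C_k_on_bounded_linear:
  assumes "open U" "bounded_linear L" "C_k_on k f U"
  shows "C_k_on k (\<lambda>x. L (f x)) U"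
  using assms(3)
proof (induction k arbitrary: f)
  case 0
  then show ?case by (auto intro: bounded_linear.continuous_on[OF assms(2)])
next
  case (Suc k)
  note f = C_k_on_SucD[OF Suc.prems]
  show ?case
    by (rule C_k_on_SucI[OF \<open>open U\<close> bounded_linear.has_derivative[OF assms(2) f(1)]
          Suc.IH[OF f(2)]])
qed

lemma C_k_on_mult:
  fixes f g :: "'a::euclidean_space \<Rightarrow> real"
  assumes "open U" "C_k_on k f U" "C_k_on k g U"
  shows "C_k_on k (\<lambda>x. f x * g x) U"
  using assms(2,3)
proof (induction k arbitrary: f g)
  case 0
  then show ?case by (auto intro: continuous_on_mult)
next
  case (Suc k)
  note f = C_k_on_SucD[OF Suc.prems(1)] and g = C_k_on_SucD[OF Suc.prems(2)]
  \<comment> \<open>The Leibniz rule keeps one factor undifferentiated; that factor is used only at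
    order \<open>k\<close>, one less than it has.\<close>
  have D: "C_k_on k (\<lambda>x. f x * frechet_derivative g (at x) v + frechet_derivative f (at x) v * g x) U" for v
    by (intro C_k_on_add[OF \<open>open U\<close>] Suc.IH f(2) g(2)
        C_k_on_Suc_imp[OF Suc.prems(1)] C_k_on_Suc_imp[OF Suc.prems(2)])
  show ?case
    by (rule C_k_on_SucI[OF \<open>open U\<close> has_derivative_mult[OF f(1) g(1)] D])
qed

lemma C_k_on_inverse:
  fixes f :: "'a::euclidean_space \<Rightarrow> real"
  assumes "open U" "\<And>x. x \<in> U \<Longrightarrow> f x \<noteq> 0" "C_k_on k f U"
  shows "C_k_on k (\<lambda>x. inverse (f x)) U"
  using assms(3)
proof (induction k)
  case 0
  then show ?case using assms(2) by (auto intro: continuous_on_inverse)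
next
  case (Suc k)
  note f = C_k_on_SucD[OF Suc.prems]
  \<comment> \<open>The derivative -f'/f^2 contains 1/f again, so the induction hypothesis is
    applied to the same \<open>f\<close>, lowered by one order.\<close>
  have I: "C_k_on k (\<lambda>x. inverse (f x)) U"
    using Suc C_k_on_Suc_imp by blast
  show ?case
  proof (rule C_k_on_SucI[OF \<open>open U\<close> Deriv.has_derivative_inverse[OF assms(2) f(1)]])
    fix v
    show "C_k_on k (\<lambda>x. - (inverse (f x) * frechet_derivative f (at x) v * inverse (f x))) U"
      by (intro C_k_on_bounded_linear[where L=uminus] C_k_on_mult I f(2) assms(1)
          bounded_linear_minus bounded_linear_ident)
  qed
qed

section \<open>Closure rules for smooth functions\<close>

lemma smooth_on_cong:
  assumes "open U" "\<And>x. x \<in> U \<Longrightarrow> f x = g x" "smooth_on f U"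
  shows "smooth_on g U"
  using assms C_k_on_cong unfolding smooth_on_def by blast

lemma smooth_on_const: "smooth_on (\<lambda>_. c) U"
  by (simp add: smooth_on_def C_k_on_const)

lemma smooth_on_add:
  "open U \<Longrightarrow> smooth_on f U \<Longrightarrow> smooth_on g U \<Longrightarrow> smooth_on (\<lambda>x. f x + g x) U"
  by (simp add: smooth_on_def C_k_on_add)

lemma smooth_on_mult:
  fixes f g :: "'a::euclidean_space \<Rightarrow> real"
  shows "open U \<Longrightarrow> smooth_on f U \<Longrightarrow> smooth_on g U \<Longrightarrow> smooth_on (\<lambda>x. f x * g x) U"
  by (simp add: smooth_on_def C_k_on_mult)

lemma smooth_on_inverse:
  fixes f :: "'a::euclidean_space \<Rightarrow> real"
  shows "open U \<Longrightarrow> (\<And>x. x \<in> U \<Longrightarrow> f x \<noteq> 0) \<Longrightarrow> smooth_on f U \<Longrightarrow> smooth_on (\<lambda>x. inverse (f x)) U"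
  by (simp add: smooth_on_def C_k_on_inverse)

lemma smooth_on_bounded_linear_comp:
  "open U \<Longrightarrow> bounded_linear L \<Longrightarrow> smooth_on f U \<Longrightarrow> smooth_on (\<lambda>x. L (f x)) U"
  by (simp add: smooth_on_def C_k_on_bounded_linear)

lemma smooth_on_minus: "open U \<Longrightarrow> smooth_on f U \<Longrightarrow> smooth_on (\<lambda>x. - f x) U"
  by (rule smooth_on_bounded_linear_comp[where L=uminus])
    (auto intro: bounded_linear_minus bounded_linear_ident)

lemma smooth_on_diff:
  "open U \<Longrightarrow> smooth_on f U \<Longrightarrow> smooth_on g U \<Longrightarrow> smooth_on (\<lambda>x. f x - g x) U"
  using smooth_on_add[of U f "\<lambda>x. - g x"] smooth_on_minus[of U g] by simp

lemma smooth_on_bounded_linear: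
  assumes "open U" "bounded_linear L"
  shows "smooth_on L U"
proof -
  have "C_k_on k L U" for k
  proof (cases k)
    case 0
    then show ?thesis using assms(2) by (simp add: linear_continuous_on)
  next
    case (Suc l)
    \<comment> \<open>A linear map is its own derivative at every point, so each directional
      derivative is constant in the base point.\<close>
    show ?thesis unfolding Suc
      by (rule C_k_on_SucI[OF assms(1) bounded_linear_imp_has_derivative[OF assms(2)] C_k_on_const])
  qed
  then show ?thesis by (simp add: smooth_on_def)
qed

lemma smooth_on_sum:
  assumes "open U" "\<And>i. i \<in> I \<Longrightarrow> smooth_on (f i) U"
  shows "smooth_on (\<lambda>x. \<Sum>i\<in>I. f i x) U"
  using assms(2)
  by (induction I rule: infinite_finite_induct)
    (auto intro: smooth_on_const smooth_on_add[OF assms(1)])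

lemma smooth_on_vec_lambda:
  fixes f :: "'i::finite \<Rightarrow> 'a::euclidean_space \<Rightarrow> real"
  assumes "open U" "\<And>i. smooth_on (f i) U"
  shows "smooth_on (\<lambda>x. \<chi> i. f i x) U"
proof -
  \<comment> \<open>Expansion in the standard basis reduces vectors to sums and linear images of
    scalar functions.\<close>
  have "(\<lambda>x. \<chi> i. f i x) = (\<lambda>x. \<Sum>i\<in>UNIV. f i x *\<^sub>R axis i 1)"
    by (auto simp: vec_eq_iff axis_def if_distrib sum.delta' cong: if_cong)
  then show ?thesis
    by (simp only:) (intro smooth_on_sum[OF assms(1)]
        smooth_on_bounded_linear_comp[OF assms(1) bounded_linear_scaleR_left assms(2)])
qed

lemma smooth_on_Pair:
  assumes "open U" "smooth_on f U" "smooth_on g U"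
  shows "smooth_on (\<lambda>x. (f x, g x)) U"
proof -
  have "smooth_on (\<lambda>x. (f x, 0) + (0, g x)) U"
    by (intro smooth_on_add[OF assms(1)]
        smooth_on_bounded_linear_comp[OF assms(1)
          bounded_linear_Pair[OF bounded_linear_ident bounded_linear_zero] assms(2)]
        smooth_on_bounded_linear_comp[OF assms(1)
          bounded_linear_Pair[OF bounded_linear_zero bounded_linear_ident] assms(3)])
  then show ?thesis by simp
qed

section \<open>Coordinate functions and the open set \<open>P_plus\<close>\<close>

lemma bounded_linear_fst_nth: "bounded_linear (\<lambda>x. fst x $ i)"
  and bounded_linear_snd_nth: "bounded_linear (\<lambda>x. snd x $ i)"
  using bounded_linear_compose[OF bounded_linear_vec_nth bounded_linear_fst]
    bounded_linear_compose[OF bounded_linear_vec_nth bounded_linear_snd] by auto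

lemmas has_derivative_fst_nth [derivative_intros] =
  bounded_linear.has_derivative[OF bounded_linear_fst_nth]
lemmas has_derivative_snd_nth [derivative_intros] =
  bounded_linear.has_derivative[OF bounded_linear_snd_nth]

lemma open_P_plus: "open (P_plus :: ((real^'i::finite) \<times> (real^'i)) set)"
proof -
  have *: "P_plus = (\<Inter>i. {x :: (real^'i) \<times> (real^'i). 0 < fst x $ i})"
    by (auto simp: P_plus_def)
  show ?thesis
    unfolding * by (rule open_INT[OF finite]) (intro ballI open_Collect_less continuous_intros)
qed

text \<open>With the open set fixed, smoothness goals decompose by syntax alone; only the
  nonvanishing of inverted functions is left over.\<close>

lemmas smooth_on_P_plus_intros = smooth_on_const
  smooth_on_add[OF open_P_plus] smooth_on_diff[OF open_P_plus] smooth_on_minus[OF open_P_plus]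
  smooth_on_mult[OF open_P_plus] smooth_on_inverse[OF open_P_plus] smooth_on_sum[OF open_P_plus]
  smooth_on_vec_lambda[OF open_P_plus] smooth_on_Pair[OF open_P_plus]
  smooth_on_bounded_linear[OF open_P_plus bounded_linear_fst_nth]
  smooth_on_bounded_linear[OF open_P_plus bounded_linear_snd_nth]
  smooth_on_bounded_linear[OF open_P_plus bounded_linear_fst]
  smooth_on_bounded_linear[OF open_P_plus bounded_linear_snd]

lemma P_plus_nth_pos: "x \<in> P_plus \<Longrightarrow> 0 < fst x $ i"
  by (auto simp: P_plus_def)

lemma P_plus_nth_nonzero: "x \<in> P_plus \<Longrightarrow> fst x $ i \<noteq> 0"
  by (metis P_plus_nth_pos less_irrefl)

text \<open>A derivative depends only on the germ. This serves functions such as chart expressions,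
  which match an explicit formula only on \<open>U\<close>.\<close>

lemma frechet_derivative_eqI_on_open:
  assumes "open U" "x \<in> U" "\<And>y. y \<in> U \<Longrightarrow> g y = f y" "(f has_derivative f') (at x)"
  shows "frechet_derivative g (at x) = f'"
  using frechet_derivative_at[OF has_derivative_transform_within_open[OF assms(4,1,2)], of g] assms(3)
  by simp


section \<open>Coordinates on the group\<close>

text \<open>An explicit inverse of the chart \<open>hz\<close> over \<open>P_plus\<close>, used in
  place of \<open>inv_into\<close>.\<close>

definition affine_prod :: "(real^'i::finite) \<times> (real^'i) \<Rightarrow> 'i \<Rightarrow> real^2^2" where
  "affine_prod y = (\<lambda>i. affine_matrix (fst y $ i) (snd y $ i))"

definition chi_coord :: "(real^'i::finite) \<times> (real^'i) \<Rightarrow> (real^'i) \<times> (real^'i)" where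
  "chi_coord y = (fst y, \<chi> i. - inverse (fst y $ i) * snd y $ i)"

definition chi_coord_inv :: "(real^'i::finite) \<times> (real^'i) \<Rightarrow> (real^'i) \<times> (real^'i)" where
  "chi_coord_inv y = (fst y, \<chi> i. - (fst y $ i * snd y $ i))"

lemma hz_affine_prod [simp]: "hz (affine_prod y) = y"
  by (simp add: hz_def affine_prod_def prod_eq_iff vec_eq_iff)

lemma chi_map_eq: "chi_map g = chi_coord (hz g)"
  by (simp add: chi_map_def chi_coord_def hz_def chi_factor_def)

lemma carrier_A1_prodE:
  assumes "g \<in> carrier A1_prod"
  obtains h z where "g i = affine_matrix h z" "0 < h"
  using assms by (force simp: A1_prod_def A1_def PiE_iff)

text \<open>The second row of each group element is (0, 1), so the top row read by \<open>hz\<close>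
  loses nothing.\<close>

lemma affine_prod_hz:
  assumes "g \<in> carrier A1_prod"
  shows "affine_prod (hz g) = g"
proof
  fix i
  obtain h z where "g i = affine_matrix h z"
    using carrier_A1_prodE[OF assms] by metis
  then show "affine_prod (hz g) i = g i"
    by (simp add: affine_prod_def hz_def)
qed

lemma affine_prod_in_carrier: "y \<in> P_plus \<Longrightarrow> affine_prod y \<in> carrier A1_prod"
  unfolding A1_prod_def A1_def affine_prod_def by (auto dest: P_plus_nth_pos)

lemma hz_in_P_plus:
  assumes "g \<in> carrier A1_prod"
  shows "hz g \<in> P_plus"
proof -
  have "0 < g i $ 1 $ 1" for i
    by (rule carrier_A1_prodE[OF assms, of i]) simp
  then show ?thesis
    by (simp add: hz_def P_plus_def)
qed

lemma hz_image: "hz ` carrier A1_prod = (P_plus :: ((real^'i::finite) \<times> (real^'i)) set)"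
proof (intro equalityI subsetI)
  fix y :: "(real^'i) \<times> (real^'i)"
  assume "y \<in> P_plus"
  then show "y \<in> hz ` carrier A1_prod"
    by (intro image_eqI[of y hz "affine_prod y"] affine_prod_in_carrier) simp_all
qed (auto dest: hz_in_P_plus)

lemma inj_on_hz: "inj_on hz (carrier A1_prod)"
  by (rule inj_on_inverseI[of _ affine_prod]) (rule affine_prod_hz)

lemma inv_into_hz: "y \<in> P_plus \<Longrightarrow> inv_into (carrier A1_prod) hz y = affine_prod y"
  using inv_into_f_f[OF inj_on_hz affine_prod_in_carrier] by simp

lemma chi_coord_in_P_plus: "y \<in> P_plus \<Longrightarrow> chi_coord y \<in> P_plus"
  and chi_coord_inv_in_P_plus: "y \<in> P_plus \<Longrightarrow> chi_coord_inv y \<in> P_plus"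
  by (auto simp: P_plus_def chi_coord_def chi_coord_inv_def)

lemma chi_coord_chi_coord_inv: "y \<in> P_plus \<Longrightarrow> chi_coord (chi_coord_inv y) = y"
  and chi_coord_inv_chi_coord: "y \<in> P_plus \<Longrightarrow> chi_coord_inv (chi_coord y) = y"
  using P_plus_nth_nonzero[of y]
  by (auto simp: chi_coord_def chi_coord_inv_def prod_eq_iff vec_eq_iff)

lemma inj_on_chi_map: "inj_on chi_map (carrier A1_prod)"
  by (rule inj_on_inverseI[of _ "\<lambda>y. affine_prod (chi_coord_inv y)"])
    (simp add: affine_prod_hz chi_coord_inv_chi_coord chi_map_eq hz_in_P_plus)

lemma bij_betw_chi_map: "bij_betw chi_map (carrier A1_prod) (P_plus :: ((real^'i::finite) \<times> (real^'i)) set)"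
proof -
  have "y \<in> chi_map ` carrier A1_prod" if "y \<in> P_plus" for y :: "(real^'i) \<times> (real^'i)"
    using that chi_coord_chi_coord_inv[OF that]
      affine_prod_in_carrier[OF chi_coord_inv_in_P_plus[OF that]]
    \<comment> \<open>The preimage is found in coordinates and then turned into a group
      element.\<close>
    by (intro image_eqI[of _ _ "affine_prod (chi_coord_inv y)"]) (auto simp: chi_map_eq)
  then show ?thesis
    using inj_on_chi_map by (auto simp: bij_betw_def chi_map_eq hz_in_P_plus chi_coord_in_P_plus)
qed

text \<open>By injectivity, exhibiting one preimage in the carrier determines
  \<open>inv_into\<close>.\<close>

lemma inv_into_chi_map:
  assumes "y \<in> P_plus"
  shows "inv_into (carrier A1_prod) chi_map y = affine_prod (chi_coord_inv y)"
  using inv_into_f_f[OF inj_on_chi_map affine_prod_in_carrier[OF chi_coord_inv_in_P_plus[OF assms]]]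
  by (simp add: chi_map_eq chi_coord_chi_coord_inv assms)

lemma in_charts_chi_map:
  "y \<in> P_plus \<Longrightarrow> in_charts (carrier A1_prod) hz (\<lambda>y. y) chi_map y = chi_coord y"
  by (simp add: in_charts_def inv_into_hz chi_map_eq)

lemma in_charts_inv_chi_map:
  assumes "y \<in> P_plus"
  shows "in_charts P_plus (\<lambda>y. y) hz (inv_into (carrier A1_prod) chi_map) y = chi_coord_inv y"
  \<comment> \<open>The chart on \<open>P_plus\<close> is the identity, hence so is its
    \<open>inv_into\<close> there.\<close>
  using inv_into_f_f[of "\<lambda>y. y" P_plus y] assms
  by (simp add: in_charts_def inv_into_chi_map)

lemma smooth_on_chi_coord: "smooth_on chi_coord P_plus"
  unfolding chi_coord_def
  by (intro smooth_on_P_plus_intros) (rule P_plus_nth_nonzero)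

lemma smooth_on_chi_coord_inv: "smooth_on chi_coord_inv P_plus"
  unfolding chi_coord_inv_def by (intro smooth_on_P_plus_intros)

lemma diffeomorphism_chi_map:
  "diffeomorphism (carrier A1_prod) hz P_plus (\<lambda>y. y) chi_map"
  unfolding diffeomorphism_def hz_image image_ident
  using bij_betw_chi_map
    smooth_on_cong[OF open_P_plus in_charts_chi_map[symmetric] smooth_on_chi_coord]
    smooth_on_cong[OF open_P_plus in_charts_inv_chi_map[symmetric] smooth_on_chi_coord_inv]
  by blast

section \<open>The derivative of \<open>chi_map\<close> in coordinates\<close>

lemma has_derivative_vec_lambda:
  fixes f :: "'i::finite \<Rightarrow> 'a::real_normed_vector \<Rightarrow> real"
  assumes "\<And>i. (f i has_derivative f' i) F"
  shows "((\<lambda>x. \<chi> i. f i x) has_derivative (\<lambda>v. \<chi> i. f' i v)) F"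
proof -
  have "(\<lambda>x. \<chi> i. g i x) = (\<lambda>x. \<Sum>i\<in>UNIV. g i x *\<^sub>R axis i 1)" for g :: "'i \<Rightarrow> 'a \<Rightarrow> real"
    by (auto simp: vec_eq_iff axis_def if_distrib sum.delta' cong: if_cong)
  then show ?thesis
    using assms by (simp only:) (intro has_derivative_sum has_derivative_scaleR_left)
qed

text \<open>In each component this is d(-z/h) = z dh/h^2 - dz/h, valid because h does not vanish on
  \<open>P_plus\<close>.\<close>

lemma frechet_derivative_chi:
  assumes "x \<in> P_plus"
  shows "frechet_derivative (in_charts (carrier A1_prod) hz (\<lambda>y. y) chi_map) (at x) v =
    (fst v, \<chi> i. inverse (fst x $ i) * fst v $ i * inverse (fst x $ i) * snd x $ i
                 - inverse (fst x $ i) * snd v $ i)"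
proof -
  have "(chi_coord has_derivative (\<lambda>v. (fst v, \<chi> i.
     - inverse (fst x $ i) * snd v $ i
     + - (- (inverse (fst x $ i) * fst v $ i * inverse (fst x $ i))) * snd x $ i))) (at x)"
    unfolding chi_coord_def using P_plus_nth_nonzero[OF assms]
    by (intro has_derivative_Pair has_derivative_vec_lambda derivative_intros)
      simp
  from frechet_derivative_eqI_on_open[OF open_P_plus assms in_charts_chi_map this]
  show ?thesis by (simp add: algebra_simps)
qed


section \<open>The two forms\<close>

text \<open>Projections replace pattern matching so that the rules for coordinate functions
  apply.\<close>

lemma hz_form_eq:
  "hz_form x v = - (\<Sum>i\<in>UNIV. snd v $ i - snd x $ i * inverse (fst x $ i) * fst v $ i)"
  by (simp add: hz_form_def case_prod_beta)

lemma theta_form_eq: "theta_form x v = (\<Sum>i\<in>UNIV. fst x $ i * snd v $ i)"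
  by (simp add: theta_form_def case_prod_beta)

text \<open>\<open>theta_form\<close> is linear in the base point, so its exterior derivative has
  constant coefficients.\<close>

lemma ext_deriv1_theta_form:
  "ext_deriv1 theta_form x u v = (\<Sum>i\<in>UNIV. fst u $ i * snd v $ i - fst v $ i * snd u $ i)"
proof -
  have "((\<lambda>y. theta_form y v) has_derivative (\<lambda>u. \<Sum>i\<in>UNIV. fst u $ i * snd v $ i)) (at x)" for v
    unfolding theta_form_eq by (auto intro!: derivative_eq_intros)
  from frechet_derivative_at[OF this, symmetric] show ?thesis
    by (simp add: ext_deriv1_def sum_subtractf)
qed

text \<open>The dz terms are closed, and d(z/h) \<and> dh = (dz \<and> dh)/h because the part of
  d(z/h) along dh is killed by antisymmetry.\<close>

lemma ext_deriv1_hz_form: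
  assumes "x \<in> P_plus"
  shows "ext_deriv1 hz_form x u v =
    (\<Sum>i\<in>UNIV. inverse (fst x $ i) * (snd u $ i * fst v $ i - snd v $ i * fst u $ i))"
proof -
  have "((\<lambda>y. hz_form y v) has_derivative
     (\<lambda>u. \<Sum>i\<in>UNIV. (inverse (fst x $ i) * snd u $ i
        - snd x $ i * (inverse (fst x $ i) * fst u $ i * inverse (fst x $ i))) * fst v $ i)) (at x)" for v
    unfolding hz_form_eq using P_plus_nth_nonzero[OF assms]
    by (auto intro!: derivative_eq_intros sum.cong
        simp: sum_negf[symmetric] algebra_simps)
  from frechet_derivative_at[OF this, symmetric] show ?thesis
    by (simp add: ext_deriv1_def sum_subtractf[symmetric] algebra_simps)
qed

lemma one_form_on_hz_form: "one_form_on P_plus (hz_form :: ((real^'i::finite) \<times> (real^'i)) one_form)"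
  unfolding one_form_on_def hz_form_eq
proof (intro conjI ballI allI)
  fix x :: "(real^'i) \<times> (real^'i)"
  show "linear (\<lambda>v. - (\<Sum>i\<in>UNIV. snd v $ i - snd x $ i * inverse (fst x $ i) * fst v $ i))"
    by (rule linearI)
      (simp_all add: sum.distrib[symmetric] sum_subtractf sum_distrib_left algebra_simps)
next
  fix v :: "(real^'i) \<times> (real^'i)"
  show "smooth_on (\<lambda>x. - (\<Sum>i\<in>UNIV. snd v $ i - snd x $ i * inverse (fst x $ i) * fst v $ i)) P_plus"
    by (intro smooth_on_P_plus_intros) (rule P_plus_nth_nonzero)
qed

text \<open>For nondegeneracy: pairing with a basis vector isolates one summand. A general
  \<open>f\<close> leaves room for weights and signs.\<close>

lemma sum_axis:
  fixes f :: "'i::finite \<Rightarrow> real \<Rightarrow> real"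
  assumes "\<And>i. f i 0 = 0"
  shows "(\<Sum>i\<in>UNIV. f i (axis j 1 $ i)) = f j 1"
proof -
  have "(\<Sum>i\<in>UNIV. f i (axis j 1 $ i)) = (\<Sum>i\<in>UNIV. if i = j then f j 1 else 0)"
    using assms by (intro sum.cong) (auto simp: axis_def)
  then show ?thesis by simp
qed

section \<open>Closedness and nondegeneracy of the two exterior derivatives\<close>

lemma symplectic_form_on_theta: "symplectic_form_on P_plus (ext_deriv1 (theta_form :: ((real^'i::finite) \<times> (real^'i)) one_form))"
  unfolding symplectic_form_on_def two_form_on_def
proof (intro conjI ballI allI impI)
  fix x :: "(real^'i) \<times> (real^'i)"
  show "bilinear (ext_deriv1 theta_form x)"
    unfolding bilinear_def ext_deriv1_theta_form
    by (auto intro!: linearI simp: sum.distrib[symmetric] sum_distrib_left algebra_simps)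
  fix u v w :: "(real^'i) \<times> (real^'i)"
  show "ext_deriv1 theta_form x v v = 0"
    by (simp add: ext_deriv1_theta_form)
  show "ext_deriv2 (ext_deriv1 theta_form) x u v w = 0"
    by (simp add: ext_deriv2_def ext_deriv1_theta_form frechet_derivative_const)
next
  fix v w :: "(real^'i) \<times> (real^'i)"
  show "smooth_on (\<lambda>x. ext_deriv1 theta_form x v w) P_plus"
    unfolding ext_deriv1_theta_form by (rule smooth_on_const)
next
  fix x v :: "(real^'i) \<times> (real^'i)"
  assume *: "\<forall>w. ext_deriv1 theta_form x v w = 0"
  \<comment> \<open>Testing against the i-th basis vector in x isolates the p-component of
    \<open>v\<close>; below, the p-direction isolates its x-component up to sign.\<close>
  have "fst v $ i = 0" for i
    using *[rule_format, of "(0, axis i 1)"] sum_axis[of "\<lambda>i t. fst v $ i * t" i]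
    by (simp add: ext_deriv1_theta_form)
  moreover have "snd v $ i = 0" for i
    using *[rule_format, of "(axis i 1, 0)"] sum_axis[of "\<lambda>i t. - (t * snd v $ i)" i]
    by (simp add: ext_deriv1_theta_form)
  ultimately show "v = 0"
    by (simp add: prod_eq_iff vec_eq_iff)
qed

lemma symplectic_form_on_hz: "symplectic_form_on P_plus (ext_deriv1 (hz_form :: ((real^'i::finite) \<times> (real^'i)) one_form))"
  unfolding symplectic_form_on_def two_form_on_def
proof (intro conjI ballI allI impI)
  fix x :: "(real^'i) \<times> (real^'i)"
  assume x: "x \<in> P_plus"
  show "bilinear (ext_deriv1 hz_form x)"
    unfolding bilinear_def ext_deriv1_hz_form[OF x]
    by (auto intro!: linearI simp: sum.distrib[symmetric] sum_distrib_left algebra_simps)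
  fix u v w :: "(real^'i) \<times> (real^'i)"
  show "ext_deriv1 hz_form x v v = 0"
    by (simp add: ext_deriv1_hz_form[OF x])
  \<comment> \<open>Only the weight 1/h of each summand varies with the base point.\<close>
  have D: "frechet_derivative (\<lambda>y. ext_deriv1 hz_form y v w) (at x) =
     (\<lambda>u. \<Sum>i\<in>UNIV. - (inverse (fst x $ i) * fst u $ i * inverse (fst x $ i))
        * (snd v $ i * fst w $ i - snd w $ i * fst v $ i))" for v w
    using P_plus_nth_nonzero[OF x]
    by (intro frechet_derivative_eqI_on_open[OF open_P_plus x ext_deriv1_hz_form])
      (auto intro!: derivative_eq_intros)
  show "ext_deriv2 (ext_deriv1 hz_form) x u v w = 0"
    \<comment> \<open>Once the sums are merged, each summand is a multiple of dh \<and> dz \<and> dh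
      for a single index, hence zero.\<close>
    unfolding ext_deriv2_def D sum_subtractf[symmetric] sum.distrib[symmetric]
    by (intro sum.neutral ballI) (simp add: algebra_simps)
next
  fix v w :: "(real^'i) \<times> (real^'i)"
  show "smooth_on (\<lambda>x. ext_deriv1 hz_form x v w) P_plus"
    by (rule smooth_on_cong[OF open_P_plus ext_deriv1_hz_form[symmetric]], assumption)
      (intro smooth_on_P_plus_intros, rule P_plus_nth_nonzero)
next
  fix x v :: "(real^'i) \<times> (real^'i)"
  assume x: "x \<in> P_plus" and *: "\<forall>w. ext_deriv1 hz_form x v w = 0"
  \<comment> \<open>The same test vectors work as for \<open>theta_form\<close>; the extra weight
    1/h is nonzero and cancels.\<close>
  have "fst v $ i = 0" for i
    using *[rule_format, of "(0, axis i 1)"] P_plus_nth_nonzero[OF x, of i]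
      sum_axis[of "\<lambda>i t. - (inverse (fst x $ i) * (t * fst v $ i))" i]
    by (simp add: ext_deriv1_hz_form[OF x])
  moreover have "snd v $ i = 0" for i
    using *[rule_format, of "(axis i 1, 0)"] P_plus_nth_nonzero[OF x, of i]
      sum_axis[of "\<lambda>i t. inverse (fst x $ i) * (snd v $ i * t)" i]
    by (simp add: ext_deriv1_hz_form[OF x])
  ultimately show "v = 0"
    by (simp add: prod_eq_iff vec_eq_iff)
qed

text \<open>Substituting p = h and x = -z/h in dp \<and> dx gives dh \<and> (z dh/h^2 - dz/h) = (dz
  \<and> dh)/h in each factor.\<close>

lemma pullback2_chi_map:
  assumes "x \<in> P_plus"
  shows "pullback2 (in_charts (carrier A1_prod) hz (\<lambda>y. y) chi_map) (ext_deriv1 theta_form) x =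
    ext_deriv1 hz_form x"
  by (intro ext) (simp add: pullback2_def ext_deriv1_theta_form ext_deriv1_hz_form[OF assms]
      frechet_derivative_chi[OF assms] algebra_simps)

section \<open>Right translations and invariance\<close>

lemma in_charts_right_translation:
  assumes "b \<in> carrier A1_prod" "y \<in> P_plus"
  shows "in_charts (carrier A1_prod) hz hz (\<lambda>g. g \<otimes>\<^bsub>A1_prod\<^esub> b) y =
    (\<chi> i. fst y $ i * fst (hz b) $ i, \<chi> i. fst y $ i * snd (hz b) $ i + snd y $ i)"
proof -
  \<comment> \<open>Expressing \<open>b\<close> by its coordinates makes the matrix product rule
    applicable in every factor.\<close>
  have "b = affine_prod (hz b)"
    using assms(1) by (simp add: affine_prod_hz)
  then have "b i = affine_matrix (fst (hz b) $ i) (snd (hz b) $ i)" for i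
    by (metis affine_prod_def)
  then have "affine_prod y \<otimes>\<^bsub>A1_prod\<^esub> b = affine_prod
      (\<chi> i. fst y $ i * fst (hz b) $ i, \<chi> i. fst y $ i * snd (hz b) $ i + snd y $ i)"
    by (simp add: A1_prod_def A1_def affine_prod_def affine_matrix_mult restrict_def)
  then show ?thesis
    by (simp add: in_charts_def inv_into_hz[OF assms(2)])
qed

lemma right_invariant_hz_form: "right_invariant_one_form A1_prod hz (hz_form :: ((real^'i::finite) \<times> (real^'i)) one_form)"
  unfolding right_invariant_one_form_def hz_image
proof (intro conjI ballI ext one_form_on_hz_form)
  fix b :: "'i \<Rightarrow> real^2^2" and x v :: "(real^'i) \<times> (real^'i)"
  assume b: "b \<in> carrier A1_prod" and x: "x \<in> P_plus"
  \<comment> \<open>The translation is linear in \<open>y\<close>, with coefficients from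
    \<open>b\<close>, and so is its own derivative.\<close>
  have "((\<lambda>y. (\<chi> i. fst y $ i * fst (hz b) $ i, \<chi> i. fst y $ i * snd (hz b) $ i + snd y $ i))
      has_derivative
      (\<lambda>y. (\<chi> i. fst y $ i * fst (hz b) $ i, \<chi> i. fst y $ i * snd (hz b) $ i + snd y $ i))) (at x)"
    by (intro has_derivative_Pair has_derivative_vec_lambda derivative_intros)
  note D = frechet_derivative_eqI_on_open[OF open_P_plus x in_charts_right_translation[OF b] this]
  show "pullback1 (in_charts (carrier A1_prod) hz hz (\<lambda>g. g \<otimes>\<^bsub>A1_prod\<^esub> b)) hz_form x v = hz_form x v"
    \<comment> \<open>With a, c the coordinates of \<open>b\<close> in one factor, c dh + dz - (hc +
      z)(ha)^(-1) a dh = dz - (z/h) dh; both h and a must be nonzero to cancel.\<close>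
    using P_plus_nth_nonzero[OF x] P_plus_nth_nonzero[OF hz_in_P_plus[OF b]]
    by (auto simp: pullback1_def D in_charts_right_translation[OF b x] hz_form_eq field_simps
        intro!: sum.cong)
qed

theorem proposition8:
  fixes n :: nat
  assumes "n \<ge> 1" and "CARD('i::finite) = n + 1"
  shows "right_invariant_one_form A1_prod hz (hz_form :: ((real^'i) \<times> (real^'i)) one_form) \<and>
    symplectomorphism
      (carrier A1_prod) hz (ext_deriv1 hz_form)
      P_plus (\<lambda>y. y) (ext_deriv1 theta_form)
      (chi_map :: ('i \<Rightarrow> real^2^2) \<Rightarrow> (real^'i) \<times> (real^'i))"
  by (simp add: right_invariant_hz_form symplectomorphism_def symplectic_space_def global_chart_def
      hz_image inj_on_hz open_P_plus symplectic_form_on_hz symplectic_form_on_theta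
      diffeomorphism_chi_map pullback2_chi_map)

end
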